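(* Let $p>3$ be a prime and $\kappa\in\mathbb{Z}$ with $\kappa\not\equiv4\pmod p$. Put $\eta=16\kappa^2-68\kappa+41$ and assume $(\kappa^2-13\kappa+11)\cdot\eta\not\equiv0\pmod p$ and $5(\kappa^2-73\kappa+61)\not\equiv0\pmod p$. If either (A) $\left(\frac{\eta}{p}\right)=1$ and $\left(\frac{5}{p}\right)=\left(\frac{8\kappa-17+2s}{p}\right)=\left(\frac{8\kappa-17-2s}{p}\right)=1$, where $s\in\mathbb{F}_p$ satisfies $s^2=\eta$; or (B) $\left(\frac{\eta}{p}\right)=-1$ and $\left(\frac{5}{p}\right)=1$, then $\mathcal{G}_\kappa(p)$ contains a subdivision of $K_{3,3}$.
   Context: $\kappa$ is regarded in $\mathbb{F}_p$; $\left(\frac{\cdot}{p}\right)$ is the Legendre symbol. $\mathcal{M}_\kappa(p)=\{(x,y,z)\in\mathbb{F}_p^3 : x^2+y^2+z^2=xyz+\kappa\}$; Vieta involutions $R_1(x,y,z)=(yz-x,y,z)$, $R_2(x,y,z)=(x,zx-y,z)$, $R_3(x,y,z)=(x,y,xy-z)$. $\mathcal{G}_\kappa(p)$ is the $3$-regular graph (possibly with loops) on $\mathcal{M}_\kappa(p)$ with an edge joining $X$ and $R_i(X)$ for each vertex $X$ and each $i$. *)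

theory Defs
  imports "HOL-Number_Theory.Number_Theory" "Graph_Theory.Graph_Theory"
begin

text \<open>
  The field with \<open>p\<close> elements is represented by its canonical residues \<open>{0..<p}\<close>, with arithmetic
  carried out modulo \<open>p\<close>.
\<close>

definition markoff_points :: "int \<Rightarrow> int \<Rightarrow> (int \<times> int \<times> int) set" where
  "markoff_points \<kappa> p = {(x, y, z). x \<in> {0..<p} \<and> y \<in> {0..<p} \<and> z \<in> {0..<p}
     \<and> [x\<^sup>2 + y\<^sup>2 + z\<^sup>2 = x * y * z + \<kappa>] (mod p)}"

fun vieta1 :: "int \<Rightarrow> int \<times> int \<times> int \<Rightarrow> int \<times> int \<times> int" where
  "vieta1 p (x, y, z) = ((y * z - x) mod p, y, z)"

fun vieta2 :: "int \<Rightarrow> int \<times> int \<times> int \<Rightarrow> int \<times> int \<times> int" where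
  "vieta2 p (x, y, z) = (x, (z * x - y) mod p, z)"

fun vieta3 :: "int \<Rightarrow> int \<times> int \<times> int \<Rightarrow> int \<times> int \<times> int" where
  "vieta3 p (x, y, z) = (x, y, (x * y - z) mod p)"

text \<open>
  An undirected graph is a symmetric digraph; its arcs are the pairs \<open>(X, R\<^sub>i X)\<close>, loops included.
  Recording arcs as pairs merges only loops at a common vertex: distinct Vieta involutions change
  different coordinates, so there are no parallel edges between distinct vertices. A subdivision
  of a simple graph contains no loops, so the multiplicity of loops is immaterial below.
\<close>

definition markoff_graph :: "int \<Rightarrow> int \<Rightarrow> (int \<times> int \<times> int) pair_pre_digraph" where
  "markoff_graph \<kappa> p =
    \<lparr> pverts = markoff_points \<kappa> p,
      parcs = (\<Union>X\<in>markoff_points \<kappa> p. {(X, vieta1 p X), (X, vieta2 p X), (X, vieta3 p X)}) \<rparr>"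

lemma vieta_in_markoff_points:
  assumes "p > 0" "X \<in> markoff_points \<kappa> p"
  shows "vieta1 p X \<in> markoff_points \<kappa> p"
    and "vieta2 p X \<in> markoff_points \<kappa> p"
    and "vieta3 p X \<in> markoff_points \<kappa> p"
proof -
  obtain x y z where X: "X = (x, y, z)" by (cases X)
  have red: "[(t mod p)\<^sup>2 + b\<^sup>2 + c\<^sup>2 = (t mod p) * b * c + \<kappa>] (mod p)
      \<longleftrightarrow> [t\<^sup>2 + b\<^sup>2 + c\<^sup>2 = t * b * c + \<kappa>] (mod p)" for t b c :: int
  proof -
    have "[(t mod p)\<^sup>2 + b\<^sup>2 + c\<^sup>2 = t\<^sup>2 + b\<^sup>2 + c\<^sup>2] (mod p)"
      by (intro cong_add cong_pow) auto
    moreover have "[(t mod p) * b * c + \<kappa> = t * b * c + \<kappa>] (mod p)"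
      by (intro cong_add cong_mult) auto
    ultimately show ?thesis by (meson cong_sym cong_trans)
  qed
  have inv: "[((b * c - a) mod p)\<^sup>2 + b\<^sup>2 + c\<^sup>2 = ((b * c - a) mod p) * b * c + \<kappa>] (mod p)"
    if "[a\<^sup>2 + b\<^sup>2 + c\<^sup>2 = a * b * c + \<kappa>] (mod p)" for a b c :: int
    unfolding red using that by (simp add: cong_iff_dvd_diff power2_eq_square algebra_simps)
  from assms(2) have b: "0 \<le> x" "x < p" "0 \<le> y" "y < p" "0 \<le> z" "z < p"
    and e: "[x\<^sup>2 + y\<^sup>2 + z\<^sup>2 = x * y * z + \<kappa>] (mod p)"
    by (auto simp: markoff_points_def X)
  show "vieta1 p X \<in> markoff_points \<kappa> p" "vieta2 p X \<in> markoff_points \<kappa> p"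
    "vieta3 p X \<in> markoff_points \<kappa> p"
    using b assms(1) inv[of x y z] inv[of y z x] inv[of z x y] e
    by (simp_all add: markoff_points_def X ac_simps)
qed

lemma vieta_involution:
  assumes "X \<in> markoff_points \<kappa> p"
  shows "vieta1 p (vieta1 p X) = X" "vieta2 p (vieta2 p X) = X" "vieta3 p (vieta3 p X) = X"
  using assms by (auto simp: markoff_points_def mod_diff_right_eq)

lemma pair_pseudo_graph_markoff_graph:
  assumes "p > 0"
  shows "pair_pseudo_graph (markoff_graph \<kappa> p)"
proof -
  have pverts_eq: "pverts (markoff_graph \<kappa> p) = markoff_points \<kappa> p"
    by (simp only: markoff_graph_def pair_pre_digraph.simps)
  have fin: "finite (markoff_points \<kappa> p)"
    by (rule finite_subset[of _ "{0..<p} \<times> {0..<p} \<times> {0..<p}"]) (auto simp: markoff_points_def)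
  have sub: "parcs (markoff_graph \<kappa> p) \<subseteq> markoff_points \<kappa> p \<times> markoff_points \<kappa> p"
    unfolding markoff_graph_def pair_pre_digraph.simps
    by (intro UN_least insert_subsetI empty_subsetI SigmaI vieta_in_markoff_points[OF assms])
  have "sym (parcs (markoff_graph \<kappa> p))"
  proof (rule symI)
    fix X Y assume "(X, Y) \<in> parcs (markoff_graph \<kappa> p)"
    then have X: "X \<in> markoff_points \<kappa> p" and Y: "Y \<in> {vieta1 p X, vieta2 p X, vieta3 p X}"
      by (simp_all only: markoff_graph_def pair_pre_digraph.simps UN_iff insert_iff empty_iff
          prod.inject) blast+
    have "Y \<in> markoff_points \<kappa> p"
      using vieta_in_markoff_points[OF assms X] Y by (elim insertE emptyE) simp_all
    moreover have "X \<in> {vieta1 p Y, vieta2 p Y, vieta3 p Y}"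
      using Y by (elim insertE emptyE) (simp_all only: vieta_involution[OF X] insert_iff simp_thms)
    ultimately show "(Y, X) \<in> parcs (markoff_graph \<kappa> p)"
      by (simp only: markoff_graph_def pair_pre_digraph.simps UN_iff insert_iff empty_iff prod.inject)
        blast
  qed
  moreover have "finite (parcs (markoff_graph \<kappa> p))"
    using fin sub finite_subset by blast
  ultimately show ?thesis
    using fin sub
    by unfold_locales (simp_all only: with_proj_simps symmetric_def pverts_eq, auto)
qed

text \<open>
  This is the \<open>K\<^bsub>3,3\<^esub>\<close> part of \<^const>\<open>kuratowski_planar\<close>. The compatibility conditions built into
  \<^const>\<open>subgraph\<close> and \<^const>\<open>subdivision\<close> force \<open>G\<close>, \<open>H\<close> and \<open>K\<close> to share their tail and head
  functions, so \<open>G\<close> must have enough arcs available in its arc type. For digraphs of the form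
  \<^term>\<open>with_proj G\<close>, where every pair of vertices is a possible arc, this is no restriction.
\<close>

definition contains_K33_subdivision :: "'a pair_pre_digraph \<Rightarrow> bool" where
  "contains_K33_subdivision G \<longleftrightarrow>
    (\<exists>H K rev_K rev_H. subgraph H (with_proj G) \<and> subdivision (K, rev_K) (H, rev_H) \<and> K\<^bsub>3,3\<^esub> K)"

end

(* The vertices of the subdivision lie on three cycles of length 10. Let f be a root of
f^2 = f + 1. Rotation about a coordinate equal to f or -f has order 5, so the two Vieta involutions
fixing such a coordinate generate a cycle of length 10. Under (A) or (B), f can be chosen with
4 kappa - 6 - 5 f a nonzero square; this is the discriminant of the equation for z in (f, f, z), so
there are two points (f, f, z), joined by R_3. After the change of sign z -> -z the surface and the
moves become symmetric in the coordinates, and the cycles x = f, y = f and z = f pairwise share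
one edge. The six ends of the three shared edges are the branch vertices of a K_{3,3}: its nine
edges are the three shared edges and the six paths that remain of the cycles, each with three inner
vertices. The hypotheses on kappa exclude coincidences among the 24 points. *)

theory Submission
  imports Defs
begin

section \<open>Squares and linear congruences modulo \<open>p\<close>\<close>

text \<open>By Euler's criterion a counterexample would give \<open>-1 = (-1) * (-1)\<close> modulo
  \<open>p\<close>, hence \<open>p dvd 2\<close>. Multiples of \<open>p\<close> also count as
  \<open>QuadRes\<close>.\<close>

lemma QuadRes_product_cases:
  fixes p x y :: int
  assumes "prime p" "p > 2" "\<not> QuadRes p (x * y)"
  shows "QuadRes p x \<or> QuadRes p y"
proof (rule ccontr)
  assume "\<not> ?thesis"
  then have non: "\<not> QuadRes p x" "\<not> QuadRes p y" by auto
  have nonzero: "\<not> [z = 0] (mod p)" if "\<not> QuadRes p z" for z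
  proof
    assume "[z = 0] (mod p)"
    then have "[0\<^sup>2 = z] (mod p)" by (simp add: cong_sym)
    with that show False unfolding QuadRes_def by blast
  qed
  let ?e = "(nat p - 1) div 2"
  have "prime (nat p)" "2 < nat p" "int (nat p) = p"
    using assms(1,2) by simp_all
  then have euler: "[Legendre z p = z ^ ?e] (mod p)" for z
    using euler_criterion[of "nat p" z] by simp
  have "Legendre x p = -1" "Legendre y p = -1" "Legendre (x * y) p = -1"
    using non assms(3) nonzero by (simp_all add: Legendre_def)
  with euler[of x] euler[of y] euler[of "x * y"]
  have e: "[-1 = x ^ ?e] (mod p)" "[-1 = y ^ ?e] (mod p)" "[-1 = x ^ ?e * y ^ ?e] (mod p)"
    by (simp_all only: power_mult_distrib)
  have "[-1 = (-1) * (-1)] (mod p)"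
    using cong_trans[OF e(3) cong_sym[OF cong_mult[OF e(1,2)]]] .
  then have "p dvd 2" by (simp add: cong_iff_dvd_diff)
  then have "p \<le> 2" by (rule zdvd_imp_le) simp
  with assms(2) show False by simp
qed

lemma QuadRes_if_Legendre:
  assumes "Legendre a p = 1"
  shows "QuadRes p a"
  using assms by (auto simp: Legendre_def split: if_splits)

lemma cong_double_cancel:
  fixes p x y :: int
  assumes "odd p" "[2 * x = 2 * y] (mod p)"
  shows "[x = y] (mod p)"
  using assms cong_mult_lcancel[of 2 p x y] by simp

lemma cong_half:
  fixes p x :: int
  assumes "odd p"
  obtains y where "[2 * y = x] (mod p)"
proof -
  from assms obtain h where "p = 2 * h + 1" by (rule oddE)
  then have "2 * ((h + 1) * x) - x = p * x" by (simp add: algebra_simps)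
  then have "[2 * ((h + 1) * x) = x] (mod p)"
    by (simp add: cong_iff_dvd_diff)
  then show thesis by (rule that)
qed

text \<open>Ideal membership certificates: \<open>q\<close>, \<open>r\<close>, \<open>s\<close> are
  cofactors writing \<open>x - y\<close> through the given congruences. The explicit terms in later
  uses are such cofactors; what remains is an integer identity.\<close>

lemma cong_lincomb3:
  fixes p a a' b b' c c' x y q r s :: int
  assumes "[a = a'] (mod p)" "[b = b'] (mod p)" "[c = c'] (mod p)"
    and "x - y = q * (a - a') + r * (b - b') + s * (c - c')"
  shows "[x = y] (mod p)"
  using assms unfolding cong_iff_dvd_diff by (simp only: dvd_add dvd_mult)

lemma cong_lincomb2:
  fixes p a a' b b' x y q r :: int
  assumes "[a = a'] (mod p)" "[b = b'] (mod p)" "x - y = q * (a - a') + r * (b - b')"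
  shows "[x = y] (mod p)"
  using cong_lincomb3[OF assms(1,2) cong_refl[of 0], of x y q r 0] assms(3) by simp

section \<open>Golden ratios modulo \<open>p\<close> and the choice of \<open>f\<close> and
  \<open>w\<close>\<close>

lemma golden_ratio_cong:
  fixes p r f :: int
  assumes "odd p" "[r\<^sup>2 = 5] (mod p)" "[2 * f = 1 + r] (mod p)"
  shows "[f\<^sup>2 = f + 1] (mod p)"
proof -
  have "[2 * (2 * f\<^sup>2) = 2 * (2 * (f + 1))] (mod p)"
    by (rule cong_lincomb2[OF assms(2,3), of _ _ 1 "2 * f - 1 + r"])
      (simp add: power2_eq_square algebra_simps)
  then show ?thesis using assms(1) cong_double_cancel by blast
qed

text \<open>
  The quadratic for \<open>w\<close> says that \<open>(f, f, - w)\<close> lies on the surface, with \<open>f\<^sup>2\<close> reduced to \<open>f + 1\<close>.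
\<close>

lemma markoff_root_exists:
  fixes p f \<kappa> :: int
  assumes "odd p" and f: "[f\<^sup>2 = f + 1] (mod p)" and "QuadRes p (4 * \<kappa> - 6 - 5 * f)"
  obtains w where "[w\<^sup>2 + (f + 1) * w + 2 * f + 2 = \<kappa>] (mod p)"
proof -
  obtain t where t: "[t\<^sup>2 = 4 * \<kappa> - 6 - 5 * f] (mod p)"
    using assms(3) unfolding QuadRes_def ..
  \<comment> \<open>Quadratic formula: \<open>(f + 1)^2 - 4 * (2 * f + 2 - \<kappa>)\<close> reduces
    to \<open>4 * \<kappa> - 6 - 5 * f\<close>.\<close>
  obtain w where w: "[2 * w = t - f - 1] (mod p)"
    using cong_half[OF assms(1)] .
  have "[2 * (2 * (w\<^sup>2 + (f + 1) * w + 2 * f + 2)) = 2 * (2 * \<kappa>)] (mod p)"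
    by (rule cong_lincomb3[OF f t w, of _ _ "-1" 1 "2 * w + f + 1 + t"])
      (simp add: power2_eq_square algebra_simps)
  then show thesis using assms(1) cong_double_cancel that by blast
qed

text \<open>Replacing \<open>f\<close> by its conjugate \<open>1 - f\<close> exchanges the factors,
  so the product is the norm of \<open>4 * \<kappa> - 6 - 5 * f\<close>.\<close>

lemma golden_discriminant_product:
  fixes p f \<kappa> :: int
  assumes "[f\<^sup>2 = f + 1] (mod p)"
  shows "[(4 * \<kappa> - 6 - 5 * f) * (4 * \<kappa> - 11 + 5 * f) = 16 * \<kappa>\<^sup>2 - 68 * \<kappa> + 41] (mod p)"
  by (rule cong_lincomb2[OF assms cong_refl[of 0], of _ _ "-25" 0])
    (simp add: power2_eq_square algebra_simps)

text \<open>A nested radical: \<open>(a + b)^2\<close> is four times the discriminant, so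
  \<open>(a + b) / 2\<close> is a square root of it.\<close>

lemma golden_discriminant_square:
  fixes p \<kappa> s a b r f :: int
  assumes "odd p" and a: "[a\<^sup>2 = 8 * \<kappa> - 17 + 2 * s] (mod p)" and b: "[b\<^sup>2 = 8 * \<kappa> - 17 - 2 * s] (mod p)"
    and ab: "[a * b = - 5 * r] (mod p)" and f: "[2 * f = 1 + r] (mod p)"
  shows "QuadRes p (4 * \<kappa> - 6 - 5 * f)"
proof -
  obtain t where t: "[2 * t = a + b] (mod p)"
    using cong_half[OF assms(1)] .
  have ab2: "[(a + b)\<^sup>2 = 16 * \<kappa> - 34 - 10 * r] (mod p)"
    by (rule cong_lincomb3[OF a b ab, of _ _ 1 1 2]) (simp add: power2_eq_square algebra_simps)
  have "[2 * (2 * t\<^sup>2) = 2 * (2 * (4 * \<kappa> - 6 - 5 * f))] (mod p)"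
    by (rule cong_lincomb3[OF t ab2 f, of _ _ "2 * t + a + b" 1 10])
      (simp add: power2_eq_square algebra_simps)
  then show ?thesis
    using assms(1) cong_double_cancel unfolding QuadRes_def by blast
qed

text \<open>Modulo \<open>p\<close>, \<open>(8 * \<kappa> - 17)^2 - 4 * s^2 = 125\<close>, so
  \<open>a * b\<close> and \<open>5 * r\<close> have the same square.\<close>

lemma root_product_square:
  fixes p \<kappa> s a b r :: int
  assumes s: "[s\<^sup>2 = 16 * \<kappa>\<^sup>2 - 68 * \<kappa> + 41] (mod p)" and r: "[r\<^sup>2 = 5] (mod p)"
    and a: "[a\<^sup>2 = 8 * \<kappa> - 17 + 2 * s] (mod p)" and b: "[b\<^sup>2 = 8 * \<kappa> - 17 - 2 * s] (mod p)"
  shows "[(a * b - 5 * r) * (a * b + 5 * r) = 0] (mod p)"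
proof -
  have ab: "[(a * b)\<^sup>2 = (8 * \<kappa> - 17 + 2 * s) * (8 * \<kappa> - 17 - 2 * s)] (mod p)"
    using cong_mult[OF a b] by (simp add: power_mult_distrib)
  show ?thesis
    by (rule cong_lincomb3[OF ab s r, of _ _ 1 "-4" "-25"])
      (simp add: power2_eq_square algebra_simps)
qed

lemma markoff_parameters_exist:
  fixes p \<kappa> \<eta> :: int
  assumes p: "prime p" "p > 3" and \<eta>: "\<eta> = 16 * \<kappa>\<^sup>2 - 68 * \<kappa> + 41"
    and cases: "(Legendre \<eta> p = 1 \<and> Legendre 5 p = 1 \<and>
           (\<exists>s\<in>{0..<p}. [s\<^sup>2 = \<eta>] (mod p) \<and>
              Legendre (8 * \<kappa> - 17 + 2 * s) p = 1 \<and> Legendre (8 * \<kappa> - 17 - 2 * s) p = 1))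
         \<or> (Legendre \<eta> p = -1 \<and> Legendre 5 p = 1)"
  obtains f w where "[f\<^sup>2 = f + 1] (mod p)" "[w\<^sup>2 + (f + 1) * w + 2 * f + 2 = \<kappa>] (mod p)"
proof -
  have odd: "odd p" using p by (simp add: prime_odd_int)
  have "QuadRes p 5" using cases QuadRes_if_Legendre by blast
  then obtain r where r: "[r\<^sup>2 = 5] (mod p)" unfolding QuadRes_def ..
  from cases have "\<exists>f. [f\<^sup>2 = f + 1] (mod p) \<and> QuadRes p (4 * \<kappa> - 6 - 5 * f)"
  proof (elim disjE conjE bexE)
    fix s assume s: "[s\<^sup>2 = \<eta>] (mod p)"
      and ls: "Legendre (8 * \<kappa> - 17 + 2 * s) p = 1" "Legendre (8 * \<kappa> - 17 - 2 * s) p = 1"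
    obtain a where a: "[a\<^sup>2 = 8 * \<kappa> - 17 + 2 * s] (mod p)"
      using QuadRes_if_Legendre[OF ls(1)] unfolding QuadRes_def ..
    obtain b where b: "[b\<^sup>2 = 8 * \<kappa> - 17 - 2 * s] (mod p)"
      using QuadRes_if_Legendre[OF ls(2)] unfolding QuadRes_def ..
    have "p dvd (a * b - 5 * r) * (a * b + 5 * r)"
      using root_product_square[OF s[unfolded \<eta>] r a b] by (simp add: cong_0_iff)
    then have "p dvd a * b - 5 * r \<or> p dvd a * b + 5 * r"
      using p(1) prime_dvd_mult_iff by blast
    \<comment> \<open>The sign of \<open>a * b\<close> decides which root of 5, and so which golden
      ratio, is taken.\<close>
    then obtain r' where "[r'\<^sup>2 = 5] (mod p)" "[a * b = - 5 * r'] (mod p)"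
    proof
      assume "p dvd a * b - 5 * r"
      then show thesis using r by (intro that[of "- r"]) (simp_all add: cong_iff_dvd_diff)
    next
      assume "p dvd a * b + 5 * r"
      then show thesis using r by (intro that[of r]) (simp_all add: cong_iff_dvd_diff)
    qed
    moreover obtain f where "[2 * f = 1 + r'] (mod p)"
      using cong_half[OF odd] .
    ultimately show ?thesis
      using golden_ratio_cong[OF odd] golden_discriminant_square[OF odd a b] by blast
  next
    assume "Legendre \<eta> p = -1"
    then have non: "\<not> QuadRes p \<eta>" by (auto simp: Legendre_def split: if_splits)
    obtain f where "[2 * f = 1 + r] (mod p)"
      using cong_half[OF odd] .
    then have f: "[f\<^sup>2 = f + 1] (mod p)" by (rule golden_ratio_cong[OF odd r])
    \<comment> \<open>The conjugate golden ratio serves when \<open>f\<close> fails: the product of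
      the two discriminants is a nonsquare, so one of them is a square.\<close>
    then have f': "[(1 - f)\<^sup>2 = (1 - f) + 1] (mod p)"
      by (simp add: cong_iff_dvd_diff power2_eq_square algebra_simps)
    have "\<not> QuadRes p ((4 * \<kappa> - 6 - 5 * f) * (4 * \<kappa> - 11 + 5 * f))"
      using non golden_discriminant_product[OF f, of \<kappa>] cong_trans
      unfolding QuadRes_def \<eta> by blast
    then have "QuadRes p (4 * \<kappa> - 6 - 5 * f) \<or> QuadRes p (4 * \<kappa> - 11 + 5 * f)"
      using QuadRes_product_cases[OF p(1)] p(2) by simp
    then have "QuadRes p (4 * \<kappa> - 6 - 5 * f) \<or> QuadRes p (4 * \<kappa> - 6 - 5 * (1 - f))"
      by (simp add: algebra_simps)
    then show ?thesis using f f' by blast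
  qed
  then show thesis using markoff_root_exists[OF odd] that by blast
qed

section \<open>Coincidences among the coordinates\<close>

context
  fixes p f w \<kappa> :: int
  assumes f: "[f\<^sup>2 = f + 1] (mod p)" and w: "[w\<^sup>2 + (f + 1) * w + 2 * f + 2 = \<kappa>] (mod p)"
begin

text \<open>The roots of the quadratic sum to \<open>- f - 1\<close>. Hence the results below also
  apply to the other root in place of \<open>w\<close>.\<close>

lemma markoff_root_other: "[(- f - 1 - w)\<^sup>2 + (f + 1) * (- f - 1 - w) + 2 * f + 2 = \<kappa>] (mod p)"
proof -
  have "(- f - 1 - w)\<^sup>2 + (f + 1) * (- f - 1 - w) = w\<^sup>2 + (f + 1) * w"
    by (simp add: power2_eq_square algebra_simps)
  with w show ?thesis by simp
qed

text \<open>Setting \<open>w = f\<close> gives \<open>\<kappa> = 5 * f + 4\<close>; the norm of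
  \<open>\<kappa> - 4 - 5 * f\<close> eliminates \<open>f\<close>.\<close>

lemma golden_cong_root_imp:
  assumes "[f = w] (mod p)"
  shows "[\<kappa>\<^sup>2 - 13 * \<kappa> + 11 = 0] (mod p)"
proof -
  have "[\<kappa> = 5 * f + 4] (mod p)"
    by (rule cong_lincomb3[OF f w assms, of _ _ 2 "-1" "- (w + 2 * f + 1)"])
      (simp add: power2_eq_square algebra_simps)
  then show ?thesis
    by (rule cong_lincomb2[OF _ f, of _ _ _ _ "\<kappa> + 5 * f - 9" 25])
      (simp add: power2_eq_square algebra_simps)
qed

text \<open>Since \<open>f * (f - 1) = 1\<close>, \<open>f\<close> cancels and
  \<open>w = -2\<close>, where the quadratic takes the value 4.\<close>

lemma golden_cong_next_imp:
  assumes "[f = - f * w - f] (mod p)"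
  shows "[\<kappa> = 4] (mod p)"
  by (rule cong_lincomb3[OF f w assms,
        of _ _ "- (w + 2) * (w + f - 1)" "-1" "(f - 1) * (w + f - 1)"])
    (simp add: power2_eq_square algebra_simps)

text \<open>Since \<open>f + 1 = f^2\<close>, this forces \<open>f * w = -1\<close>, so
  \<open>w = 1 - f\<close>, where the quadratic again takes the value 4.\<close>

lemma root_cong_next_imp:
  assumes "[w = - f * w - f] (mod p)"
  shows "[\<kappa> = 4] (mod p)"
  by (rule cong_lincomb3[OF f w assms,
        of _ _ "(w + 1) * (w - f + 1) + 1" "-1" "(2 - f) * (w - f + 1) + 1"])
    (simp add: power2_eq_square algebra_simps)

text \<open>The assumption amounts to \<open>(f - 1) * w = 1\<close>, and \<open>f\<close> is the
  inverse of \<open>f - 1\<close>.\<close>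

lemma next_cong_other_root_imp:
  assumes "[- f * w - f = - f - 1 - w] (mod p)"
  shows "[f = w] (mod p)"
  by (rule cong_lincomb2[OF f assms, of _ _ w f])
    (simp add: power2_eq_square algebra_simps)

text \<open>A double root makes the discriminant vanish, and its norm with it.\<close>

lemma roots_cong_imp:
  assumes "[w = - f - 1 - w] (mod p)"
  shows "[16 * \<kappa>\<^sup>2 - 68 * \<kappa> + 41 = 0] (mod p)"
proof -
  have "[4 * \<kappa> - 6 - 5 * f = 0] (mod p)"
    by (rule cong_lincomb3[OF f w assms, of _ _ "-1" "-4" "2 * w + f + 1"])
      (simp add: power2_eq_square algebra_simps)
  then have "[(4 * \<kappa> - 6 - 5 * f) * (4 * \<kappa> - 11 + 5 * f) = 0 * (4 * \<kappa> - 11 + 5 * f)] (mod p)"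
    by (rule cong_mult) simp
  then have "[(4 * \<kappa> - 6 - 5 * f) * (4 * \<kappa> - 11 + 5 * f) = 0] (mod p)"
    by simp
  with cong_sym[OF golden_discriminant_product[OF f, of \<kappa>]] show ?thesis
    by (rule cong_trans)
qed

lemma next_cong_next_imp:
  assumes "[- f * w - f = - f * (- f - 1 - w) - f] (mod p)"
  shows "[w = - f - 1 - w] (mod p)"
  by (rule cong_lincomb2[OF f assms, of _ _ "- f - 1 - 2 * w" "- (f - 1)"])
    (simp add: power2_eq_square algebra_simps)

end

section \<open>Subdivisions built from paths\<close>

text \<open>\<open>H\<close> is a partly subdivided \<open>K\<close>, and \<open>P\<close> lists the
  edges of \<open>H\<close> still to be replaced by paths of \<open>G\<close> with inner vertices
  \<open>ws\<close>. Each round splits off the first inner vertex of the first path, or drops an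
  entry that has none. Once \<open>P\<close> is empty, \<open>H\<close> lies in
  \<open>G\<close>.\<close>

lemma subdivision_pair_paths:
  fixes G H K :: "'a pair_pre_digraph" and P :: "('a \<times> 'a list \<times> 'a) list"
  assumes "pair_pseudo_graph G" "subdivision_pair K H" "pverts H \<subseteq> pverts G"
    and "\<forall>(u, ws, v)\<in>set P. (u, v) \<in> parcs H \<and> set ws \<subseteq> pverts G
          \<and> successively (\<lambda>x y. (x, y) \<in> parcs G) (u # ws @ [v])"
    and "parcs H \<subseteq> parcs G \<union> (\<Union>(u, ws, v)\<in>set P. {(u, v), (v, u)})"
    and "distinct (map (\<lambda>(u, ws, v). {u, v}) P)"
    and "distinct (concat (map (\<lambda>(u, ws, v). ws) P))"
    and "pverts H \<inter> (\<Union>(u, ws, v)\<in>set P. set ws) = {}"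
  shows "\<exists>H'. subgraph (with_proj H') (with_proj G) \<and> subdivision_pair K H'"
  using assms(2-)
\<comment> \<open>\<open>Suc\<close> makes the measure fall also when an entry without inner
  vertices is dropped.\<close>
proof (induction "\<Sum>(u, ws, v)\<leftarrow>P. Suc (length ws)" arbitrary: P H rule: less_induct)
  case less
  interpret G: pair_pseudo_graph G by fact
  interpret H: pair_bidirected_digraph H
    using less.prems(1) by (rule bidirected_digraphI_subdivision)
  show ?case
  proof (cases P)
    case Nil
    then have "subgraph (with_proj H) (with_proj G)"
      using less.prems(2,4) G.wf_digraph H.wf_digraph by (intro subgraphI) (auto simp: compatible_def)
    then show ?thesis using less.prems(1) by blast
  next
    case (Cons e P')
    obtain u ws v where e: "e = (u, ws, v)" by (cases e)
    show ?thesis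
    proof (cases ws)
      case ws: Nil
      have "(u, v) \<in> parcs G"
        using less.prems(3) unfolding Cons e ws by simp
      then have "(v, u) \<in> parcs G" by (rule G.arcs_symmetric)
      show ?thesis
        using less.prems \<open>(u, v) \<in> parcs G\<close> \<open>(v, u) \<in> parcs G\<close>
        by (intro less.hyps[of P' H]) (auto simp: Cons e ws)
    next
      case ws: (Cons x ws')
      have uv: "(u, v) \<in> parcs H" and ux: "(u, x) \<in> parcs G" and x: "x \<in> pverts G" "x \<notin> pverts H"
        using less.prems(3,7) by (auto simp: Cons e ws)
      have xu: "(x, u) \<in> parcs G" using ux by (rule G.arcs_symmetric)
      have in_H: "a \<in> pverts H \<and> b \<in> pverts H" if "(a, us, b) \<in> set P" for a us b
        using that less.prems(3) H.wellformed' by fast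
      let ?H = "subdivide H (u, v) x" and ?P = "(x, ws', v) # P'"
      \<comment> \<open>Subdividing deletes both orientations of the edge, so no other entry may use
        it; hence the distinctness of unordered pairs.\<close>
      have keep: "(u, us, v) \<notin> set P'" "(v, us, u) \<notin> set P'" for us
        using less.prems(5) by (force simp: Cons e image_iff)+
      have "subdivision_pair K ?H"
        using uv x(2) less.prems(1) by (rule subdivision_pair_divide)
      moreover have "pverts ?H \<subseteq> pverts G"
        using less.prems(2) x by simp
      moreover have "\<forall>(a, us, b)\<in>set ?P. (a, b) \<in> parcs ?H \<and> set us \<subseteq> pverts G
          \<and> successively (\<lambda>x y. (x, y) \<in> parcs G) (a # us @ [b])"
        using less.prems(3) keep by (auto simp: Cons e ws)
      moreover have "parcs ?H \<subseteq> parcs G \<union> (\<Union>(a, us, b)\<in>set ?P. {(a, b), (b, a)})"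
        using less.prems(4) ux xu by (auto simp: Cons e ws)
      moreover have "distinct (map (\<lambda>(a, us, b). {a, b}) ?P)"
      proof -
        have "{x, v} \<noteq> {a, b}" if "(a, us, b) \<in> set P'" for a us b
          using in_H[of a us b] that x(2) by (auto simp: Cons doubleton_eq_iff)
        then show ?thesis using less.prems(5) by (fastforce simp: Cons e)
      qed
      moreover have "distinct (concat (map (\<lambda>(a, us, b). us) ?P))"
        using less.prems(6) by (simp add: Cons e ws)
      moreover have "pverts ?H \<inter> (\<Union>(a, us, b)\<in>set ?P. set us) = {}"
        using less.prems(6,7) by (fastforce simp: Cons e ws)
      ultimately show ?thesis
        by (intro less.hyps[of ?P ?H]) (simp_all add: Cons e ws)
    qed
  qed
qed

section \<open>Vieta moves in sign-changed coordinates\<close>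

text \<open>In these coordinates the surface is \<open>x\<^sup>2 + y\<^sup>2 + z\<^sup>2 + x y z = \<kappa>\<close> and \<open>R\<^sub>1\<close> sends \<open>x\<close> to \<open>- y z - x\<close>.\<close>

definition reflect :: "int \<Rightarrow> int \<Rightarrow> int \<Rightarrow> int \<Rightarrow> int \<times> int \<times> int" where
  "reflect p x y z = (x, y, (- z) mod p)"

lemma reflect_eq_iff:
  assumes "z \<in> {0..<p}" "z' \<in> {0..<p}"
  shows "reflect p x y z = reflect p x' y' z' \<longleftrightarrow> x = x' \<and> y = y' \<and> z = z'"
proof -
  have "z = z'" if "[- z = - z'] (mod p)"
    using that assms cong_less_imp_eq_int[of z p z'] by (simp add: cong_minus_minus_iff)
  then show ?thesis by (auto simp: reflect_def cong_def)
qed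

lemma reflect_in_markoff_points:
  assumes "x \<in> {0..<p}" "y \<in> {0..<p}" "[x\<^sup>2 + y\<^sup>2 + z\<^sup>2 + x * y * z = \<kappa>] (mod p)"
  shows "reflect p x y z \<in> markoff_points \<kappa> p"
proof -
  have "[(- z) mod p = - z] (mod p)" by simp
  then have "[x\<^sup>2 + y\<^sup>2 + ((- z) mod p)\<^sup>2 = x * y * ((- z) mod p) + \<kappa>] (mod p)"
    by (rule cong_lincomb2[OF _ assms(3), of _ _ _ _ "(- z) mod p - z - x * y" 1])
      (simp add: power2_eq_square algebra_simps)
  then show ?thesis using assms(1,2) by (simp add: reflect_def markoff_points_def)
qed

lemma markoff_graph_sel:
  "pverts (markoff_graph \<kappa> p) = markoff_points \<kappa> p"
  "parcs (markoff_graph \<kappa> p) =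
    (\<Union>X\<in>markoff_points \<kappa> p. {(X, vieta1 p X), (X, vieta2 p X), (X, vieta3 p X)})"
  by (simp_all only: markoff_graph_def pair_pre_digraph.simps)

text \<open>With two coordinates fixed, the surface equation is a quadratic in the third whose roots
  sum to minus the product of the fixed ones; the move exchanges the roots.\<close>

lemma reflect_arc:
  assumes X: "reflect p x y z \<in> markoff_points \<kappa> p"
  shows "x' \<in> {0..<p} \<Longrightarrow> [x + x' = - (y * z)] (mod p) \<Longrightarrow>
      (reflect p x y z, reflect p x' y z) \<in> parcs (markoff_graph \<kappa> p)"
    and "y' \<in> {0..<p} \<Longrightarrow> [y + y' = - (x * z)] (mod p) \<Longrightarrow>
      (reflect p x y z, reflect p x y' z) \<in> parcs (markoff_graph \<kappa> p)"
    and "[z + z' = - (x * y)] (mod p) \<Longrightarrow>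
      (reflect p x y z, reflect p x y z') \<in> parcs (markoff_graph \<kappa> p)"
proof -
  have neg: "[(- z) mod p = - z] (mod p)" by simp
  { assume "x' \<in> {0..<p}" and sum: "[x + x' = - (y * z)] (mod p)"
    have "[y * ((- z) mod p) - x = x'] (mod p)"
      by (rule cong_lincomb2[OF neg sum, of _ _ y "-1"]) (simp add: algebra_simps)
    then have "reflect p x' y z = vieta1 p (reflect p x y z)"
      using \<open>x' \<in> {0..<p}\<close> by (simp add: reflect_def cong_def)
    then show "(reflect p x y z, reflect p x' y z) \<in> parcs (markoff_graph \<kappa> p)"
      using X by (auto simp only: markoff_graph_sel) }
  { assume "y' \<in> {0..<p}" and sum: "[y + y' = - (x * z)] (mod p)"
    have "[((- z) mod p) * x - y = y'] (mod p)"
      by (rule cong_lincomb2[OF neg sum, of _ _ x "-1"]) (simp add: algebra_simps)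
    then have "reflect p x y' z = vieta2 p (reflect p x y z)"
      using \<open>y' \<in> {0..<p}\<close> by (simp add: reflect_def cong_def)
    then show "(reflect p x y z, reflect p x y' z) \<in> parcs (markoff_graph \<kappa> p)"
      using X by (auto simp only: markoff_graph_sel) }
  { assume sum: "[z + z' = - (x * y)] (mod p)"
    have "[x * y - ((- z) mod p) = - z'] (mod p)"
      by (rule cong_lincomb2[OF neg sum, of _ _ "-1" 1]) (simp add: algebra_simps)
    then have "reflect p x y z' = vieta3 p (reflect p x y z)"
      by (simp add: reflect_def cong_def)
    then show "(reflect p x y z, reflect p x y z') \<in> parcs (markoff_graph \<kappa> p)"
      using X by (auto simp only: markoff_graph_sel) }
qed

section \<open>The three cycles and the subdivision of K_{3,3}\<close>

text \<open>
  \<open>f, w, b, c, u\<close> is one period of the recurrence \<open>s\<^sub>n\<^sub>+\<^sub>1 = - f s\<^sub>n - s\<^sub>n\<^sub>-\<^sub>1\<close>; along the cycle \<open>x = f\<close>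
  the other two coordinates are consecutive terms of it.
\<close>

lemma contains_K33_subdivision_markoff:
  fixes p \<kappa> f w b c u :: int
  assumes "{f, w, b, c, u} \<subseteq> {0..<p}" and "distinct [f, w, b, c, u]"
    and rec: "[u + w = - (f * f)] (mod p)" "[f + b = - (f * w)] (mod p)" "[w + c = - (f * b)] (mod p)"
      "[b + u = - (f * c)] (mod p)" "[c + f = - (f * u)] (mod p)"
    and surface: "[f\<^sup>2 + w\<^sup>2 + f\<^sup>2 + f * w * f = \<kappa>] (mod p)"
  shows "contains_K33_subdivision (markoff_graph \<kappa> p)"
proof -
  let ?G = "markoff_graph \<kappa> p" and ?R = "reflect p"
  have range: "x \<in> {0..<p}" if "x \<in> {f, w, b, c, u}" for x using that assms(1) by blast
  define on_surface where "on_surface y z \<longleftrightarrow> [f\<^sup>2 + y\<^sup>2 + z\<^sup>2 + f * y * z = \<kappa>] (mod p)" for y z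
  have swap: "on_surface z y" if "on_surface y z" for y z
    using that by (simp add: on_surface_def algebra_simps)
  \<comment> \<open>The left side changes by \<open>(z' - z) * (z + z' + f * y)\<close>.\<close>
  have step: "on_surface y z'" if "on_surface y z" "[z + z' = - (f * y)] (mod p)" for y z z'
    unfolding on_surface_def
    by (rule cong_lincomb2[OF that[unfolded on_surface_def], of _ _ 1 "z' - z"])
      (simp add: power2_eq_square algebra_simps)
  have wf: "on_surface w f" using surface unfolding on_surface_def .
  have bw: "on_surface b w" using step[OF wf rec(2)] by (rule swap)
  have cb: "on_surface c b" using step[OF bw rec(3)] by (rule swap)
  have uc: "on_surface u c" using step[OF cb rec(4)] by (rule swap)
  have fu: "on_surface f u" using step[OF uc rec(5)] by (rule swap)
  \<comment> \<open>The surface is now symmetric, so \<open>f\<close> may stand in any position and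
    the other two in either order.\<close>
  have points: "?R f y z \<in> pverts ?G" "?R f z y \<in> pverts ?G" "?R y f z \<in> pverts ?G"
      "?R z f y \<in> pverts ?G" "?R y z f \<in> pverts ?G" "?R z y f \<in> pverts ?G"
    if "on_surface y z" "{y, z} \<subseteq> {f, w, b, c, u}" for y z
  proof -
    have r: "f \<in> {0..<p}" "y \<in> {0..<p}" "z \<in> {0..<p}"
      using range that(2) by simp_all
    have "[f\<^sup>2 + y\<^sup>2 + z\<^sup>2 + f * y * z = \<kappa>] (mod p)" "[f\<^sup>2 + z\<^sup>2 + y\<^sup>2 + f * z * y = \<kappa>] (mod p)"
      "[y\<^sup>2 + f\<^sup>2 + z\<^sup>2 + y * f * z = \<kappa>] (mod p)" "[z\<^sup>2 + f\<^sup>2 + y\<^sup>2 + z * f * y = \<kappa>] (mod p)"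
      "[y\<^sup>2 + z\<^sup>2 + f\<^sup>2 + y * z * f = \<kappa>] (mod p)" "[z\<^sup>2 + y\<^sup>2 + f\<^sup>2 + z * y * f = \<kappa>] (mod p)"
      using that(1) unfolding on_surface_def by (simp_all only: ac_simps)
    then show "?R f y z \<in> pverts ?G" "?R f z y \<in> pverts ?G" "?R y f z \<in> pverts ?G"
      "?R z f y \<in> pverts ?G" "?R y z f \<in> pverts ?G" "?R z y f \<in> pverts ?G"
      unfolding markoff_graph_sel using r by (blast intro: reflect_in_markoff_points)+
  qed
  have arcs: "(?R f y z, ?R f y z') \<in> parcs ?G" "(?R f z y, ?R f z' y) \<in> parcs ?G"
      "(?R y f z, ?R y f z') \<in> parcs ?G" "(?R z f y, ?R z' f y) \<in> parcs ?G"
      "(?R y z f, ?R y z' f) \<in> parcs ?G" "(?R z y f, ?R z' y f) \<in> parcs ?G"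
    if "on_surface y z" "[z + z' = - (f * y)] (mod p)" "{y, z, z'} \<subseteq> {f, w, b, c, u}" for y z z'
  proof -
    have z': "z' \<in> {0..<p}" using range that(3) by simp
    have yf: "[z + z' = - (y * f)] (mod p)" using that(2) by (simp only: mult.commute)
    note P = points[of y z, unfolded markoff_graph_sel, OF that(1)]
    have yz: "{y, z} \<subseteq> {f, w, b, c, u}" using that(3) by simp
    show "(?R f y z, ?R f y z') \<in> parcs ?G" by (rule reflect_arc(3)[OF P(1)[OF yz] that(2)])
    show "(?R f z y, ?R f z' y) \<in> parcs ?G" by (rule reflect_arc(2)[OF P(2)[OF yz] z' that(2)])
    show "(?R y f z, ?R y f z') \<in> parcs ?G" by (rule reflect_arc(3)[OF P(3)[OF yz] yf])
    show "(?R z f y, ?R z' f y) \<in> parcs ?G" by (rule reflect_arc(1)[OF P(4)[OF yz] z' that(2)])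
    show "(?R y z f, ?R y z' f) \<in> parcs ?G" by (rule reflect_arc(2)[OF P(5)[OF yz] z' yf])
    show "(?R z y f, ?R z' y f) \<in> parcs ?G" by (rule reflect_arc(1)[OF P(6)[OF yz] z' yf])
  qed
  have S: "f \<in> {f, w, b, c, u}" "w \<in> {f, w, b, c, u}" "b \<in> {f, w, b, c, u}"
    "c \<in> {f, w, b, c, u}" "u \<in> {f, w, b, c, u}" by simp_all
  note eq = reflect_eq_iff[OF range range]
  note neq = assms(2)[simplified]
  have fw: "on_surface f w" using wf by (rule swap)
  have wu: "[w + u = - (f * f)] (mod p)" using rec(1) by (simp only: add.commute)
  note verts = points[OF fu] points[OF fw] points[OF bw] points[OF cb] points[OF uc]
  note path_arcs = arcs[OF fw wu] arcs[OF wf rec(2)] arcs[OF bw rec(3)] arcs[OF cb rec(4)] arcs[OF uc rec(5)]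
  \<comment> \<open>Letters name the shared edges: \<open>A\<close> lies on the cycles
    \<open>x = f\<close> and \<open>y = f\<close>, \<open>B\<close> on \<open>x = f\<close> and
    \<open>z = f\<close>, \<open>C\<close> on \<open>y = f\<close> and \<open>z = f\<close>. Index 0
    marks the end with \<open>u\<close>, index 1 the end with \<open>w\<close>.\<close>
  let ?A0 = "?R f f u" and ?B0 = "?R f u f" and ?C0 = "?R u f f"
  let ?A1 = "?R f f w" and ?B1 = "?R f w f" and ?C1 = "?R w f f"
  let ?U = "{?A0, ?B0, ?C0}" and ?V = "{?A1, ?B1, ?C1}"
  let ?K = "\<lparr>pverts = ?U \<union> ?V, parcs = ?U \<times> ?V \<union> ?V \<times> ?U\<rparr>"
  \<comment> \<open>One row for each of the cycles \<open>x = f\<close>, \<open>y = f\<close>,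
    \<open>z = f\<close>: removing its two shared edges leaves two paths, each from
    \<open>?V\<close> to \<open>?U\<close>.\<close>
  let ?P = "[(?A1, [?R f b w, ?R f b c, ?R f u c], ?B0), (?B1, [?R f w b, ?R f c b, ?R f c u], ?A0),
    (?A1, [?R b f w, ?R b f c, ?R u f c], ?C0), (?C1, [?R w f b, ?R c f b, ?R c f u], ?A0),
    (?B1, [?R b w f, ?R b c f, ?R u c f], ?C0), (?C1, [?R w b f, ?R c b f, ?R c u f], ?B0)]"
  have "p > 0" using range[OF S(1)] by simp
  then interpret G: pair_pseudo_graph ?G by (rule pair_pseudo_graph_markoff_graph)
  have disj: "?U \<inter> ?V = {}" and card: "card ?U = 3" "card ?V = 3"
    using neq by (simp_all add: eq S card_insert_if)
  have K33: "K\<^bsub>3,3\<^esub> (with_proj ?K)"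
    unfolding complete_bipartite_digraph_pair_def using disj card by (intro conjI exI[of _ ?U] exI[of _ ?V]) simp_all
  then interpret K: pair_graph ?K by (rule pair_graphI_complete_bipartite)
  have "pair_bidirected_digraph ?K" by unfold_locales
  then have base: "subdivision_pair ?K ?K" by (rule subdivision_pair_base)
  have direct: "(?A1, ?A0) \<in> parcs ?G" "(?B1, ?B0) \<in> parcs ?G" "(?C1, ?C0) \<in> parcs ?G"
    using path_arcs by simp_all
  have "\<exists>H. subgraph (with_proj H) (with_proj ?G) \<and> subdivision_pair ?K H"
  proof (rule subdivision_pair_paths[where P = ?P, OF G.pair_pseudo_graph_axioms base])
    show "pverts ?K \<subseteq> pverts ?G"
      using verts by simp
    show "\<forall>(x, ws, y)\<in>set ?P. (x, y) \<in> parcs ?K \<and> set ws \<subseteq> pverts ?G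
          \<and> successively (\<lambda>x y. (x, y) \<in> parcs ?G) (x # ws @ [y])"
      using verts path_arcs by simp
    show "parcs ?K \<subseteq> parcs ?G \<union> (\<Union>(x, ws, y)\<in>set ?P. {(x, y), (y, x)})"
      using direct direct[THEN G.arcs_symmetric] by simp
    show "distinct (map (\<lambda>(x, ws, y). {x, y}) ?P)"
      using neq by (simp add: eq S doubleton_eq_iff)
    show "distinct (concat (map (\<lambda>(x, ws, y). ws) ?P))"
      using neq by (auto simp: eq S)
    show "pverts ?K \<inter> (\<Union>(x, ws, y)\<in>set ?P. set ws) = {}"
      using neq by (simp add: eq S)
  qed
  then show ?thesis
    using K33 unfolding contains_K33_subdivision_def by blast
qed

text \<open>The period is built from \<open>f\<close> in both directions, \<open>w\<close>,
  \<open>b\<close> forwards and \<open>u\<close>, \<open>c\<close> backwards. Reversal exchanges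
  \<open>w\<close> with \<open>u\<close> and \<open>b\<close> with \<open>c\<close>, so applying the
  coincidence lemmas to both roots covers all ten pairs.\<close>

lemma contains_K33_subdivision_of_root:
  fixes p \<kappa> f w :: int
  assumes "p > 0" and \<kappa>: "\<not> [\<kappa> = 4] (mod p)"
      "\<not> [16 * \<kappa>\<^sup>2 - 68 * \<kappa> + 41 = 0] (mod p)" "\<not> [\<kappa>\<^sup>2 - 13 * \<kappa> + 11 = 0] (mod p)"
    and f: "[f\<^sup>2 = f + 1] (mod p)" and w: "[w\<^sup>2 + (f + 1) * w + 2 * f + 2 = \<kappa>] (mod p)"
  shows "contains_K33_subdivision (markoff_graph \<kappa> p)"
proof -
  define u where "u = - f - 1 - w"
  define b where "b = - f * w - f"
  define c where "c = - f * u - f"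
  have u: "[u\<^sup>2 + (f + 1) * u + 2 * f + 2 = \<kappa>] (mod p)"
    using markoff_root_other[OF f w] by (simp only: u_def)
  have w_eq: "w = - f - 1 - u" by (simp add: u_def)
  have "\<not> [f = w] (mod p)" "\<not> [f = u] (mod p)"
    using \<kappa>(3) golden_cong_root_imp[OF f w] golden_cong_root_imp[OF f u] by blast+
  moreover have "\<not> [f = b] (mod p)" "\<not> [f = c] (mod p)"
    using \<kappa>(1) golden_cong_next_imp[OF f w] golden_cong_next_imp[OF f u] unfolding b_def c_def by blast+
  moreover have "\<not> [w = b] (mod p)" "\<not> [u = c] (mod p)"
    using \<kappa>(1) root_cong_next_imp[OF f w] root_cong_next_imp[OF f u] unfolding b_def c_def by blast+
  moreover have "\<not> [w = u] (mod p)"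
    using \<kappa>(2) roots_cong_imp[OF f w] unfolding u_def by blast
  moreover have "\<not> [b = c] (mod p)"
    using next_cong_next_imp[OF f w] \<open>\<not> [w = u] (mod p)\<close> unfolding b_def c_def u_def by blast
  moreover have "\<not> [b = u] (mod p)"
    using next_cong_other_root_imp[OF f w] \<open>\<not> [f = w] (mod p)\<close> unfolding b_def u_def by blast
  moreover have "\<not> [c = w] (mod p)"
    using next_cong_other_root_imp[OF f u] \<open>\<not> [f = u] (mod p)\<close> unfolding c_def w_eq[symmetric] by blast
  ultimately have "distinct [f mod p, w mod p, b mod p, c mod p, u mod p]"
    by (auto simp: cong_def)
  moreover have "{f mod p, w mod p, b mod p, c mod p, u mod p} \<subseteq> {0..<p}"
    using assms(1) by simp
  moreover have lift: "[x mod p + y mod p = - ((f mod p) * (z mod p))] (mod p)"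
    if "[x + y = - (f * z)] (mod p)" for x y z
  proof -
    have "[x mod p + y mod p = x + y] (mod p)" by (simp add: cong_def mod_simps)
    also note that
    also have "[- (f * z) = - ((f mod p) * (z mod p))] (mod p)"
      unfolding cong_minus_minus_iff by (simp add: cong_def mod_simps)
    finally show ?thesis .
  qed
  \<comment> \<open>This relation and those for \<open>w + c\<close> and \<open>b + u\<close> are
    not built into the definitions; they follow from \<open>f^2 = f + 1\<close>, which closes the
    period after five terms.\<close>
  have "[u + w = - (f * f)] (mod p)"
    by (rule cong_lincomb2[OF f w, of _ _ 1 0]) (simp add: u_def power2_eq_square algebra_simps)
  note lift[OF this]
  moreover have "[f + b = - (f * w)] (mod p)" by (simp add: b_def)
  note lift[OF this]
  moreover have "[w + c = - (f * b)] (mod p)"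
    by (rule cong_lincomb2[OF f w, of _ _ "- w" 0])
      (simp add: b_def c_def u_def power2_eq_square algebra_simps)
  note lift[OF this]
  moreover have "[b + u = - (f * c)] (mod p)"
    by (rule cong_lincomb2[OF f w, of _ _ "w + f + 1" 0])
      (simp add: b_def c_def u_def power2_eq_square algebra_simps)
  note lift[OF this]
  moreover have "[c + f = - (f * u)] (mod p)" by (simp add: c_def)
  note lift[OF this]
  moreover have "[f\<^sup>2 + w\<^sup>2 + f\<^sup>2 + f * w * f = \<kappa>] (mod p)"
    by (rule cong_lincomb2[OF f w, of _ _ "w + 2" 1]) (simp add: power2_eq_square algebra_simps)
  with _ have "[(f mod p)\<^sup>2 + (w mod p)\<^sup>2 + (f mod p)\<^sup>2 + (f mod p) * (w mod p) * (f mod p) = \<kappa>] (mod p)"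
    by (rule cong_trans) (intro cong_add cong_mult cong_pow; simp)
  ultimately show ?thesis
    by (intro contains_K33_subdivision_markoff)
qed

theorem theorem4p4:
  fixes p \<kappa> \<eta> :: int
  assumes "prime p" and "p > 3"
    and "\<not> [\<kappa> = 4] (mod p)"
    and "\<eta> = 16 * \<kappa>\<^sup>2 - 68 * \<kappa> + 41"
    and "\<not> [(\<kappa>\<^sup>2 - 13 * \<kappa> + 11) * \<eta> = 0] (mod p)"
    and "\<not> [5 * (\<kappa>\<^sup>2 - 73 * \<kappa> + 61) = 0] (mod p)"
    and "(Legendre \<eta> p = 1 \<and> Legendre 5 p = 1 \<and>
           (\<exists>s\<in>{0..<p}. [s\<^sup>2 = \<eta>] (mod p) \<and>
              Legendre (8 * \<kappa> - 17 + 2 * s) p = 1 \<and> Legendre (8 * \<kappa> - 17 - 2 * s) p = 1))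
         \<or> (Legendre \<eta> p = -1 \<and> Legendre 5 p = 1)"
  shows "contains_K33_subdivision (markoff_graph \<kappa> p)"
proof -
  obtain f w where f: "[f\<^sup>2 = f + 1] (mod p)" and w: "[w\<^sup>2 + (f + 1) * w + 2 * f + 2 = \<kappa>] (mod p)"
    using markoff_parameters_exist[OF assms(1,2,4,7)] .
  have "\<not> p dvd (\<kappa>\<^sup>2 - 13 * \<kappa> + 11) * \<eta>"
    using assms(5) by (simp add: cong_0_iff)
  then have "\<not> [\<eta> = 0] (mod p)" "\<not> [\<kappa>\<^sup>2 - 13 * \<kappa> + 11 = 0] (mod p)"
    by (auto simp: cong_0_iff)
  then show ?thesis
    using contains_K33_subdivision_of_root[OF _ assms(3) _ _ f w] assms(2,4) by simp
qed

end
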